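(* Let $q\ge 1$ be an integer. Then for every integer $n\ge 1$, $$b_n-nb_{n-1}=\begin{cases}(q-1)b_{n-q}+q(-1)^{\frac{n}{q}}, & \text{if } q\mid n,\\ (q-1)b_{n-q}, & \text{otherwise.}\end{cases}$$
   Context: $S_n$ is the set of all permutations of $[n]=\{1,2,\ldots,n\}$ (with $S_0$ consisting of the single empty permutation). For a fixed integer $q\ge 1$, an adjacent $q$-cycle (A$q$C) of a permutation $\pi\in S_n$ is a cycle of length $q$ in the disjoint cycle decomposition of $\pi$ of the form $(a,a+1,a+2,\ldots,a+q-1)$, i.e. $\pi(a+i)=a+i+1$ for $0\le i\le q-2$ and $\pi(a+q-1)=a$ (for $q=1$ this is a fixed point). For fixed $q$, $b_n$ denotes the number of permutations in $S_n$ having no A$q$C's (so $b_0=1$ for every $q\ge1$). Convention: $b_m=0$ for $m<0$. *)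

theory Defs
  imports Main "HOL-Combinatorics.Permutations"
begin

text \<open>The elements of \<open>S\<^sub>n\<close> are the functions \<open>p\<close> with \<open>p permutes {1..n}\<close>; these fix every
  natural number outside \<open>{1..n}\<close>, so the whole cycle is required to lie inside \<open>{1..n}\<close>
  (this matters for \<open>q = 1\<close>).\<close>

definition adjacent_cycle :: "nat \<Rightarrow> nat \<Rightarrow> (nat \<Rightarrow> nat) \<Rightarrow> nat \<Rightarrow> bool" where
  "adjacent_cycle q n p a \<longleftrightarrow>
     {a..a + q - 1} \<subseteq> {1..n} \<and>
     (\<forall>i. i + 1 < q \<longrightarrow> p (a + i) = a + i + 1) \<and>
     p (a + q - 1) = a"

definition perms_without_adjacent_cycles :: "nat \<Rightarrow> nat \<Rightarrow> (nat \<Rightarrow> nat) set" where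
  "perms_without_adjacent_cycles q n =
     {p. p permutes {1..n} \<and> \<not> (\<exists>a. adjacent_cycle q n p a)}"

text \<open>The index is an integer so that \<open>b\<^sub>m = 0\<close> for negative \<open>m\<close> can be expressed.\<close>

definition b_seq :: "nat \<Rightarrow> int \<Rightarrow> int" where
  "b_seq q m = (if m < 0 then 0 else int (card (perms_without_adjacent_cycles q (nat m))))"

end

theory Submission
  imports Defs
begin

text \<open>
  The number \<open>b\<^sub>n\<close> is found by inclusion and exclusion over the starting points of the adjacent
  \<open>q\<close>-cycles. Two different adjacent \<open>q\<close>-cycles of one permutation are disjoint, so only
  sets \<open>J\<close> of starting points of pairwise disjoint intervals of length \<open>q\<close> inside \<open>{1..n}\<close>
  occur; such a set is called a packing here. If \<open>J\<close> has \<open>j\<close> elements, a permutation with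
  adjacent cycles at all points of \<open>J\<close> is determined by an arbitrary permutation of the remaining
  \<open>n - q * j\<close> points (\<open>card_perms_with_adjacent_cycles\<close>). Contracting every interval of a packing
  to a point shows that there are \<open>(n - (q - 1) * j) choose j\<close> packings with \<open>j\<close> intervals;
  \<open>card_packings_of_size\<close> proves this by Pascal's rule. Hence
  \<open>b\<^sub>n = (\<Sum>j. (- 1) ^ j * T n j)\<close> with
  \<open>T n j = ((n - (q - 1) * j) choose j) * fact (n - q * j)\<close>, which for \<open>q * j \<le> n\<close> equals
  \<open>fact (n - (q - 1) * j) / fact j\<close>.

  The recurrence then holds almost term by term. Put \<open>N = n - (q - 1) * j\<close> with
  \<open>j \<ge> 1\<close> and \<open>q * j < n\<close>. From \<open>fact N - n * fact (N - 1) = - (q - 1) * j * fact (N - 1)\<close>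
  follows \<open>T n j - n * T (n - 1) j = - (q - 1) * T (n - q) (j - 1)\<close>. The terms with \<open>j = 0\<close>
  cancel, and those with \<open>q * j > n\<close> vanish. Only \<open>q * j = n\<close> is exceptional: there
  \<open>T n j = T (n - q) (j - 1) = 1\<close> while \<open>T (n - 1) j = 0\<close>, so the identity is off by
  \<open>1 + (q - 1) = q\<close>, which is the extra summand when \<open>q\<close> divides \<open>n\<close>
  (\<open>packing_term_recurrence\<close>).
\<close>

section \<open>Permutations with a prescribed restriction\<close>

text \<open>Composing with \<open>inv c\<close> turns a permutation that agrees with \<open>c\<close> on \<open>U\<close> into one that
  fixes \<open>U\<close> pointwise.\<close>

lemma bij_betw_extensions_of_permutation:
  assumes c: "c permutes U" and US: "U \<subseteq> S"
  shows "bij_betw (\<lambda>r. c \<circ> r) {r. r permutes S - U} {p. p permutes S \<and> (\<forall>x\<in>U. p x = c x)}"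
proof (rule bij_betw_byWitness[where f' = "\<lambda>p. inv c \<circ> p"])
  have cS: "c permutes S"
    using c US by (rule permutes_subset)
  show "\<forall>r\<in>{r. r permutes S - U}. inv c \<circ> (c \<circ> r) = r"
    using permutes_inverses[OF c] by (auto simp: fun_eq_iff)
  show "\<forall>p\<in>{p. p permutes S \<and> (\<forall>x\<in>U. p x = c x)}. c \<circ> (inv c \<circ> p) = p"
    using permutes_inverses[OF c] by (auto simp: fun_eq_iff)
  show "(\<lambda>r. c \<circ> r) ` {r. r permutes S - U} \<subseteq> {p. p permutes S \<and> (\<forall>x\<in>U. p x = c x)}"
  proof clarify
    fix r assume r: "r permutes S - U"
    then have "r permutes S"
      by (rule permutes_subset) auto
    then show "c \<circ> r permutes S \<and> (\<forall>x\<in>U. (c \<circ> r) x = c x)"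
      using permutes_compose[OF _ cS] permutes_not_in[OF r] by auto
  qed
  show "(\<lambda>p. inv c \<circ> p) ` {p. p permutes S \<and> (\<forall>x\<in>U. p x = c x)} \<subseteq> {r. r permutes S - U}"
  proof clarify
    fix p assume p: "p permutes S" and eq: "\<forall>x\<in>U. p x = c x"
    have "inv c \<circ> p permutes S"
      using permutes_compose[OF p permutes_inv[OF cS]] .
    moreover have "(inv c \<circ> p) x = x" if "x \<in> S - (S - U)" for x
      using that eq permutes_inverses[OF c] by auto
    ultimately show "inv c \<circ> p permutes S - U"
      by (rule permutes_superset)
  qed
qed

lemma card_extensions_of_permutation:
  assumes "finite S" and "c permutes U" and "U \<subseteq> S"
  shows "card {p. p permutes S \<and> (\<forall>x\<in>U. p x = c x)} = fact (card S - card U)"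
proof -
  have "card {p. p permutes S \<and> (\<forall>x\<in>U. p x = c x)} = card {r. r permutes S - U}"
    using bij_betw_same_card[OF bij_betw_extensions_of_permutation[OF assms(2,3)]] by simp
  also have "\<dots> = fact (card (S - U))"
    using assms(1) by (intro card_permutations) auto
  finally show ?thesis
    using assms by (simp add: card_Diff_subset finite_subset)
qed

section \<open>Packings of intervals\<close>

text \<open>A packing is represented by the left endpoints of its intervals.\<close>

definition packings :: "nat \<Rightarrow> nat \<Rightarrow> nat set set" where
  "packings q n = {J. J \<subseteq> {1..n} \<and> (\<forall>a\<in>J. a + q \<le> Suc n) \<and>
     (\<forall>a\<in>J. \<forall>b\<in>J. a < b \<longrightarrow> a + q \<le> b)}"

lemma packings_subset: "J \<in> packings q n \<Longrightarrow> J \<subseteq> {1..n}"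
  by (simp add: packings_def)

lemma finite_packing: "J \<in> packings q n \<Longrightarrow> finite J"
  by (rule finite_subset[OF packings_subset]) simp_all

lemma finite_packings [simp]: "finite (packings q n)"
  by (rule finite_subset[of _ "Pow {1..n}"]) (auto simp: packings_def)

lemma packings_downward_closed: "J \<in> packings q n \<Longrightarrow> I \<subseteq> J \<Longrightarrow> I \<in> packings q n"
  unfolding packings_def by blast

lemma card_packing_le: "J \<in> packings q n \<Longrightarrow> card J \<le> n"
  using card_mono[of "{1..n}" J] packings_subset[of J q n] by simp

lemma packings_too_short: "n < q \<Longrightarrow> packings q n = {{}}"
  unfolding packings_def by fastforce

text \<open>Of the packings of \<open>{1..m + Suc r}\<close>, those with an interval at the last possible position
  \<open>Suc m\<close> arise from packings of \<open>{1..m}\<close>, and the others fit into \<open>{1..m + r}\<close>.\<close>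

lemma packings_step:
  "packings (Suc r) (m + Suc r) = packings (Suc r) (m + r) \<union> insert (Suc m) ` packings (Suc r) m"
proof (intro equalityI subsetI)
  fix J assume J: "J \<in> packings (Suc r) (m + Suc r)"
  have bound: "a \<le> Suc m" if "a \<in> J" for a
    using J that by (auto simp: packings_def)
  show "J \<in> packings (Suc r) (m + r) \<union> insert (Suc m) ` packings (Suc r) m"
  proof (cases "Suc m \<in> J")
    case True
    have fits: "a + Suc r \<le> Suc m" if "a \<in> J - {Suc m}" for a
    proof -
      have "a < Suc m"
        using that bound[of a] by (simp add: le_neq_implies_less)
      then show ?thesis
        using J that True unfolding packings_def by blast
    qed
    have "J - {Suc m} \<subseteq> {1..m}"
      using packings_subset[OF J] fits by fastforce
    then have "J - {Suc m} \<in> packings (Suc r) m"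
      using J fits unfolding packings_def by blast
    then show ?thesis
      using True by (metis UnI2 imageI insert_Diff)
  next
    case False
    then have "a \<le> m" if "a \<in> J" for a
      using bound[of a] that le_Suc_eq by blast
    then have "J \<in> packings (Suc r) (m + r)"
      using J unfolding packings_def by fastforce
    then show ?thesis by simp
  qed
next
  fix J assume "J \<in> packings (Suc r) (m + r) \<union> insert (Suc m) ` packings (Suc r) m"
  then consider (old) "J \<in> packings (Suc r) (m + r)"
    | (new) I where "I \<in> packings (Suc r) m" "J = insert (Suc m) I"
    by blast
  then show "J \<in> packings (Suc r) (m + Suc r)"
  proof cases
    case old
    then show ?thesis
      by (auto simp: packings_def)
  next
    case new
    then have le: "a \<le> m" and fits: "a + Suc r \<le> Suc m" if "a \<in> I" for a
      using that by (auto simp: packings_def)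
    have "J \<subseteq> {1..m + Suc r}"
      using new packings_subset[OF new(1)] by fastforce
    moreover have "a + Suc r \<le> Suc (m + Suc r)" if "a \<in> J" for a
      using that new(2) le[of a] by auto
    moreover have "a + Suc r \<le> b" if "a \<in> J" "b \<in> J" "a < b" for a b
    proof (cases "b = Suc m")
      case True
      then show ?thesis
        using that new(2) fits[of a] by auto
    next
      case False
      then have "b \<in> I" "a \<in> I"
        using that new(2) le[of b] by auto
      then show ?thesis
        using new(1) \<open>a < b\<close> unfolding packings_def by blast
    qed
    ultimately show ?thesis
      unfolding packings_def by blast
  qed
qed

text \<open>By \<open>packings_step\<close> the counts satisfy Pascal's rule. The truncated subtraction is harmless:
  if \<open>n < r * j\<close>, then \<open>j > 0\<close> and \<open>0 choose j = 0\<close>.\<close>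

lemma card_packings_of_size:
  "card {J \<in> packings (Suc r) n. card J = j} = (n - r * j) choose j"
proof (induction n arbitrary: j rule: less_induct)
  case (less n)
  show ?case
  proof (cases j)
    case 0
    have "{} \<in> packings (Suc r) n"
      by (simp add: packings_def)
    then have "{J \<in> packings (Suc r) n. card J = 0} = {{}}"
      using finite_packing by auto
    then show ?thesis
      using 0 by simp
  next
    case j: (Suc i)
    show ?thesis
    proof (cases "n < Suc r")
      case True
      then have "{J \<in> packings (Suc r) n. card J = j} = {}"
        using j packings_too_short by auto
      then show ?thesis
        using True j by simp
    next
      case False
      then obtain m where n: "n = m + Suc r"
        by (metis add.commute le_Suc_ex not_le)
      let ?A = "{J \<in> packings (Suc r) (m + r). card J = j}"
      let ?B = "{J \<in> packings (Suc r) m. card J = i}"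
      have new: "Suc m \<notin> J" if "J \<in> packings (Suc r) m" for J
        using packings_subset[OF that] by auto
      have new': "Suc m \<notin> J" if "J \<in> packings (Suc r) (m + r)" for J
        using that by (force simp: packings_def)
      have "{J \<in> packings (Suc r) n. card J = j} = ?A \<union> insert (Suc m) ` ?B"
        unfolding n packings_step using j new finite_packing by (auto simp: image_iff)
      moreover have "?A \<inter> insert (Suc m) ` ?B = {}"
        using new' by auto
      moreover have "inj_on (insert (Suc m)) ?B"
        using new by (intro inj_onI) (metis (mono_tags, lifting) insert_ident mem_Collect_eq)
      ultimately have "card {J \<in> packings (Suc r) n. card J = j} = card ?A + card ?B"
        by (simp add: card_Un_disjoint card_image)
      also have "\<dots> = ((m + r - r * j) choose j) + ((m - r * i) choose i)"
        using less.IH[of "m + r" j] less.IH[of m i] n by simp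
      also have "m + r - r * j = m - r * i"
        using j by simp
      also have "((m - r * i) choose j) + ((m - r * i) choose i) = (n - r * j) choose j"
      proof (cases "r * i \<le> m")
        case True
        then have "n - r * j = Suc (m - r * i)"
          using n j by (simp add: Suc_diff_le)
        then show ?thesis
          using j by simp
      next
        case False
        \<comment> \<open>When both differences truncate to \<open>0\<close>, the equation
          \<open>(0 choose Suc i) + (0 choose i) = (0 choose Suc i)\<close> depends on \<open>i > 0\<close>.\<close>
        then have "i > 0" "n - r * j = 0" "m - r * i = 0"
          using n j by (auto intro: gr0I)
        then show ?thesis
          using j by simp
      qed
      finally show ?thesis .
    qed
  qed
qed

section \<open>Permutations containing the adjacent cycles of a packing\<close>

definition blocks :: "nat \<Rightarrow> nat set \<Rightarrow> nat set" where
  "blocks q J = (\<Union>a\<in>J. {a..<a + q})"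

text \<open>The product of the adjacent cycles starting at the points of \<open>J\<close>. A point \<open>x\<close> ends its
  block when \<open>x + 1 - q\<close> is a starting point; the guard \<open>q \<le> x + 1\<close> excludes truncation.\<close>

definition rotate_blocks :: "nat \<Rightarrow> nat set \<Rightarrow> nat \<Rightarrow> nat" where
  "rotate_blocks q J x =
     (if x \<notin> blocks q J then x else if x + 1 - q \<in> J \<and> q \<le> x + 1 then x + 1 - q else x + 1)"

lemma in_blocksI: "a \<in> J \<Longrightarrow> a \<le> x \<Longrightarrow> x < a + q \<Longrightarrow> x \<in> blocks q J"
  unfolding blocks_def by (rule UN_I) simp_all

lemma blocks_subset: "J \<in> packings q n \<Longrightarrow> blocks q J \<subseteq> {1..n}"
  by (force simp: blocks_def packings_def)

lemma card_blocks:
  assumes "J \<in> packings q n"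
  shows "card (blocks q J) = q * card J"
proof -
  have "{a..<a + q} \<inter> {b..<b + q} = {}" if "a \<in> J" "b \<in> J" "a \<noteq> b" for a b
  proof -
    have "a + q \<le> b \<or> b + q \<le> a"
      using assms that by (auto simp: packings_def dest: nat_neq_iff[THEN iffD1])
    then show ?thesis by auto
  qed
  then have "card (blocks q J) = (\<Sum>a\<in>J. card {a..<a + q})"
    unfolding blocks_def using finite_packing[OF assms] by (intro card_UN_disjoint) auto
  then show ?thesis by simp
qed

lemma rotate_blocks_last:
  assumes "a \<in> J" and "q \<ge> 1"
  shows "rotate_blocks q J (a + q - 1) = a"
proof -
  have "a + q - 1 \<in> blocks q J"
    using assms by (intro in_blocksI[of a]) simp_all
  then show ?thesis
    using assms by (simp add: rotate_blocks_def)
qed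

text \<open>An inner point of a block is not the end of another block, since the blocks of a packing do
  not overlap.\<close>

lemma rotate_blocks_inner:
  assumes J: "J \<in> packings q n" and a: "a \<in> J" and i: "i + 1 < q"
  shows "rotate_blocks q J (a + i) = a + i + 1"
proof -
  have "a + i \<in> blocks q J"
    using a i by (intro in_blocksI[of a]) simp_all
  moreover have "\<not> (a + i + 1 - q \<in> J \<and> q \<le> a + i + 1)"
  proof
    assume *: "a + i + 1 - q \<in> J \<and> q \<le> a + i + 1"
    then have "a + i + 1 - q < a"
      using i by linarith
    then have "a + i + 1 - q + q \<le> a"
      using J a * unfolding packings_def by blast
    then show False
      using * by linarith
  qed
  ultimately show ?thesis
    by (auto simp: rotate_blocks_def)
qed

lemma block_cases:
  assumes "x \<in> blocks q J"
  obtains (last) a where "a \<in> J" "x = a + q - 1"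
    | (inner) a i where "a \<in> J" "i + 1 < q" "x = a + i"
proof -
  obtain a where a: "a \<in> J" "a \<le> x" "x < a + q"
    using assms by (auto simp: blocks_def)
  show thesis
  proof (cases "x = a + q - 1")
    case True
    then show ?thesis using a last by blast
  next
    case False
    then show ?thesis using a inner[of a "x - a"] by auto
  qed
qed

lemma rotate_blocks_permutes:
  assumes J: "J \<in> packings q n" and q: "q \<ge> 1"
  shows "rotate_blocks q J permutes blocks q J"
proof (rule bij_imp_permutes)
  let ?U = "blocks q J" and ?c = "rotate_blocks q J"
  have fin: "finite ?U"
    by (rule finite_subset[OF blocks_subset[OF J]]) simp
  have memI: "a + i \<in> ?U" if "a \<in> J" "i < q" for a i
    using that by (intro in_blocksI[of a]) simp_all
  have "?U \<subseteq> ?c ` ?U"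
  proof
    fix y assume "y \<in> ?U"
    then obtain a where a: "a \<in> J" "a \<le> y" "y < a + q"
      by (auto simp: blocks_def)
    show "y \<in> ?c ` ?U"
    proof (cases "y = a")
      case True
      then have "y = ?c (a + q - 1)"
        using rotate_blocks_last[OF a(1) q] by simp
      moreover have "a + q - 1 \<in> ?U"
        using memI[OF a(1), of "q - 1"] q by simp
      ultimately show ?thesis by blast
    next
      case False
      then have "y = ?c (a + (y - a - 1))"
        using a rotate_blocks_inner[OF J a(1), of "y - a - 1"] by simp
      moreover have "a + (y - a - 1) \<in> ?U"
        using a by (intro memI) auto
      ultimately show ?thesis by blast
    qed
  qed
  moreover have "?c ` ?U \<subseteq> ?U"
  proof clarify
    fix x assume "x \<in> ?U"
    then show "?c x \<in> ?U"
    proof (cases rule: block_cases)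
      case (last a)
      then show ?thesis
        using rotate_blocks_last[OF last(1) q] memI[of a 0] q by simp
    next
      case (inner a i)
      then show ?thesis
        using rotate_blocks_inner[OF J inner(1,2)] memI[of a "i + 1"] by simp
    qed
  qed
  ultimately have "?c ` ?U = ?U" by blast
  then show "bij_betw ?c ?U ?U"
    using fin by (simp add: bij_betw_def eq_card_imp_inj_on)
qed (simp add: rotate_blocks_def)

lemma all_adjacent_cycles_iff:
  assumes J: "J \<in> packings q n" and q: "q \<ge> 1"
  shows "(\<forall>a\<in>J. adjacent_cycle q n p a) \<longleftrightarrow> (\<forall>x\<in>blocks q J. p x = rotate_blocks q J x)"
proof
  assume *: "\<forall>a\<in>J. adjacent_cycle q n p a"
  show "\<forall>x\<in>blocks q J. p x = rotate_blocks q J x"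
  proof
    fix x assume "x \<in> blocks q J"
    then show "p x = rotate_blocks q J x"
    proof (cases rule: block_cases)
      case (last a)
      then show ?thesis
        using * rotate_blocks_last[OF last(1) q] by (simp add: adjacent_cycle_def)
    next
      case (inner a i)
      then show ?thesis
        using * rotate_blocks_inner[OF J inner(1,2)] by (simp add: adjacent_cycle_def)
    qed
  qed
next
  assume *: "\<forall>x\<in>blocks q J. p x = rotate_blocks q J x"
  show "\<forall>a\<in>J. adjacent_cycle q n p a"
  proof
    fix a assume a: "a \<in> J"
    have mem: "a + i \<in> blocks q J" if "i < q" for i
      using a that by (intro in_blocksI[of a]) simp_all
    have "{a..a + q - 1} \<subseteq> {1..n}"
      using J a by (fastforce simp: packings_def)
    moreover have "p (a + i) = a + i + 1" if "i + 1 < q" for i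
      using * mem[of i] that rotate_blocks_inner[OF J a that] by simp
    moreover have "p (a + q - 1) = a"
      using * mem[of "q - 1"] q rotate_blocks_last[OF a q] by simp
    ultimately show "adjacent_cycle q n p a"
      by (simp add: adjacent_cycle_def)
  qed
qed

lemma card_perms_with_adjacent_cycles:
  assumes J: "J \<in> packings q n" and q: "q \<ge> 1"
  shows "card {p. p permutes {1..n} \<and> (\<forall>a\<in>J. adjacent_cycle q n p a)} = fact (n - q * card J)"
  unfolding all_adjacent_cycles_iff[OF J q]
  using card_extensions_of_permutation[OF _ rotate_blocks_permutes[OF J q] blocks_subset[OF J]]
  by (simp add: card_blocks[OF J])

text \<open>If a second cycle started at \<open>b\<close> inside the one at \<open>a\<close>, then \<open>b\<close> would be the image of
  \<open>b - 1\<close> in the first cycle and of \<open>b + q - 1\<close> in the second.\<close>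

lemma adjacent_cycles_packing:
  assumes p: "p permutes {1..n}" and q: "q \<ge> 1"
  shows "{a. adjacent_cycle q n p a} \<in> packings q n"
proof -
  have "a + q \<le> b" if a: "adjacent_cycle q n p a" and b: "adjacent_cycle q n p b" and "a < b" for a b
  proof (rule ccontr)
    assume "\<not> a + q \<le> b"
    then have "b - a - 1 + 1 < q"
      using \<open>a < b\<close> by linarith
    then have "p (a + (b - a - 1)) = a + (b - a - 1) + 1"
      using a unfolding adjacent_cycle_def by blast
    then have "p (b - 1) = p (b + q - 1)"
      using b \<open>a < b\<close> by (simp add: adjacent_cycle_def)
    then have "b - 1 = b + q - 1"
      using permutes_inj[OF p] by (simp add: inj_eq)
    then show False
      using \<open>a < b\<close> q by linarith
  qed
  moreover have "a \<in> {1..n} \<and> a + q \<le> Suc n" if a: "adjacent_cycle q n p a" for a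
  proof -
    have "a \<in> {a..a + q - 1}" "a + q - 1 \<in> {a..a + q - 1}"
      using q by auto
    then show ?thesis
      using a unfolding adjacent_cycle_def by fastforce
  qed
  ultimately show ?thesis
    unfolding packings_def by blast
qed

section \<open>Inclusion and exclusion\<close>

lemma alternating_sum_Pow:
  assumes "finite B"
  shows "(\<Sum>J\<in>Pow B. (- 1) ^ card J) = (if B = {} then 1 else 0 :: int)"
  using assms
proof (induction B)
  case (insert x B)
  have "inj_on (insert x) (Pow B)"
    using insert.hyps by (intro inj_onI) (metis PowD insert_ident subsetD)
  then have "(\<Sum>J\<in>insert x ` Pow B. (- 1) ^ card J) = (\<Sum>J\<in>Pow B. (- 1) ^ card (insert x J) :: int)"
    by (simp add: sum.reindex)
  also have "\<dots> = (\<Sum>J\<in>Pow B. - ((- 1) ^ card J))"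
  proof (rule sum.cong[OF refl])
    fix J assume "J \<in> Pow B"
    then have "finite J" "x \<notin> J"
      using insert.hyps by (auto intro: finite_subset)
    then show "(- 1) ^ card (insert x J) = - ((- 1) ^ card J :: int)"
      by simp
  qed
  finally show ?case
    using insert.hyps by (subst Pow_insert, subst sum.union_disjoint) (auto simp: sum_negf)
qed simp

text \<open>The alternating sum over the subsets of the set of adjacent cycles of \<open>p\<close> is the indicator
  of \<open>p\<close> having none. All these subsets are packings, so exchanging the two sums leaves a sum over
  packings.\<close>

lemma b_seq_inclusion_exclusion:
  assumes q: "q \<ge> 1"
  shows "b_seq q (int n) = (\<Sum>J\<in>packings q n. (- 1) ^ card J * fact (n - q * card J))"
proof -
  let ?S = "{p. p permutes {1..n}}"
  let ?C = "\<lambda>p. {a. adjacent_cycle q n p a}"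
  have finS: "finite ?S"
    by (rule finite_permutations) simp
  have "b_seq q (int n) = int (card {p \<in> ?S. ?C p = {}})"
    by (auto simp: b_seq_def perms_without_adjacent_cycles_def)
  also have "\<dots> = (\<Sum>p\<in>?S. if ?C p = {} then 1 else 0)"
    using finS by (simp add: sum.If_cases Int_def del: Collect_empty_eq)
  also have "\<dots> = (\<Sum>p\<in>?S. \<Sum>J\<in>Pow (?C p). (- 1) ^ card J)"
  proof (rule sum.cong[OF refl])
    fix p assume "p \<in> ?S"
    then have "finite (?C p)"
      using finite_packing[OF adjacent_cycles_packing[OF _ q]] by simp
    then show "(if ?C p = {} then 1 else 0) = (\<Sum>J\<in>Pow (?C p). (- 1) ^ card J :: int)"
      using alternating_sum_Pow[of "?C p"] by simp
  qed
  also have "\<dots> = (\<Sum>p\<in>?S. \<Sum>J\<in>{J \<in> packings q n. \<forall>a\<in>J. adjacent_cycle q n p a}. (- 1) ^ card J)"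
  proof (intro sum.cong refl)
    fix p assume "p \<in> ?S"
    then have "?C p \<in> packings q n"
      using adjacent_cycles_packing[OF _ q] by simp
    then show "Pow (?C p) = {J \<in> packings q n. \<forall>a\<in>J. adjacent_cycle q n p a}"
      using packings_downward_closed by blast
  qed
  also have "\<dots> = (\<Sum>J\<in>packings q n. \<Sum>p\<in>{p \<in> ?S. \<forall>a\<in>J. adjacent_cycle q n p a}. (- 1) ^ card J)"
    using finS by (intro sum.swap_restrict) auto
  also have "\<dots> = (\<Sum>J\<in>packings q n. (- 1) ^ card J * fact (n - q * card J))"
    using card_perms_with_adjacent_cycles[OF _ q] by (intro sum.cong) (simp_all add: mult.commute)
  finally show ?thesis .
qed

text \<open>Up to sign, the contribution of the packings with \<open>j\<close> intervals of length \<open>Suc r\<close> to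
  the inclusion-exclusion sum for \<open>n\<close>. Writing \<open>q = Suc r\<close> keeps the truncated subtraction on
  the natural numbers away from \<open>q - 1\<close>.\<close>

definition packing_term :: "nat \<Rightarrow> nat \<Rightarrow> nat \<Rightarrow> int" where
  "packing_term r n j = int ((n - r * j) choose j) * fact (n - Suc r * j)"

text \<open>Grouping the packings by their number of intervals. No packing of \<open>{1..n}\<close> has
  more than \<open>n\<close> intervals, so any upper limit \<open>K > n\<close> will do; the recurrence compares three
  such sums for different \<open>n\<close> and needs their limits to match.\<close>

lemma b_seq_formula:
  assumes "n < K"
  shows "b_seq (Suc r) (int n) = (\<Sum>j<K. (- 1) ^ j * packing_term r n j)"
proof -
  let ?P = "packings (Suc r) n"
  have "b_seq (Suc r) (int n) = (\<Sum>J\<in>?P. (- 1) ^ card J * fact (n - Suc r * card J))"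
    by (rule b_seq_inclusion_exclusion) simp
  also have "\<dots> = (\<Sum>j<K. \<Sum>J\<in>{J \<in> ?P. card J = j}. (- 1) ^ card J * fact (n - Suc r * card J))"
    using assms card_packing_le by (intro sum.group[symmetric]) (auto intro: le_less_trans)
  also have "\<dots> = (\<Sum>j<K. (- 1) ^ j * packing_term r n j)"
  proof (rule sum.cong[OF refl])
    fix j
    have "(\<Sum>J\<in>{J \<in> ?P. card J = j}. (- 1) ^ card J * fact (n - Suc r * card J))
        = (\<Sum>J\<in>{J \<in> ?P. card J = j}. (- 1) ^ j * fact (n - Suc r * j) :: int)"
      by (intro sum.cong) auto
    then show "(\<Sum>J\<in>{J \<in> ?P. card J = j}. (- 1) ^ card J * fact (n - Suc r * card J))
        = (- 1) ^ j * packing_term r n j"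
      by (simp add: card_packings_of_size packing_term_def)
  qed
  finally show ?thesis .
qed

section \<open>The recurrence\<close>

lemma packing_term_fact:
  assumes "Suc r * j \<le> n"
  shows "fact j * packing_term r n j = fact (n - r * j)"
proof -
  have "j \<le> n - r * j"
    using assms by simp
  moreover have "n - Suc r * j = n - r * j - j"
    by simp
  ultimately have "fact j * fact (n - Suc r * j) * ((n - r * j) choose j) = (fact (n - r * j) :: nat)"
    by (metis binomial_fact_lemma)
  then have "int (fact j * fact (n - Suc r * j) * ((n - r * j) choose j)) = int (fact (n - r * j))"
    by (rule arg_cong)
  then show ?thesis
    unfolding packing_term_def by (simp only: of_nat_mult of_nat_fact mult_ac)
qed

lemma packing_term_eq_0: "j > 0 \<Longrightarrow> n < Suc r * j \<Longrightarrow> packing_term r n j = 0"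
  by (auto simp: packing_term_def)

text \<open>For \<open>Suc r * i < m\<close> the identity is checked after multiplication by \<open>fact (Suc i)\<close>, where
  \<open>packing_term_fact\<close> turns every term into a multiple of \<open>fact N\<close>. At \<open>m = Suc r * i\<close> the
  middle term has no room for \<open>Suc i\<close> intervals and the two outer ones equal \<open>1\<close>, which leaves
  \<open>1 + r\<close>.\<close>

lemma packing_term_recurrence:
  "packing_term r (m + Suc r) (Suc i) - int (m + Suc r) * packing_term r (m + r) (Suc i)
     + int r * packing_term r m i = (if m = Suc r * i then int (Suc r) else 0)"
proof -
  consider (eq) "m = Suc r * i" | (gt) "m > Suc r * i" | (lt) "m < Suc r * i"
    by linarith
  then show ?thesis
  proof cases
    case eq
    then have "packing_term r (m + Suc r) (Suc i) = 1" "packing_term r m i = 1"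
      by (simp_all add: packing_term_def)
    moreover have "packing_term r (m + r) (Suc i) = 0"
      using eq by (intro packing_term_eq_0) auto
    ultimately show ?thesis
      using eq by simp
  next
    case gt
    define N where "N = m - r * i"
    have ri: "r * i \<le> m"
      using gt by simp
    have 1: "fact (Suc i) * packing_term r (m + Suc r) (Suc i) = fact (Suc N)"
      using packing_term_fact[of r "Suc i" "m + Suc r"] gt ri by (simp add: N_def Suc_diff_le)
    have 2: "fact (Suc i) * packing_term r (m + r) (Suc i) = fact N"
      using packing_term_fact[of r "Suc i" "m + r"] gt by (simp add: N_def)
    have 3: "fact (Suc i) * packing_term r m i = int (Suc i) * fact N"
      using packing_term_fact[of r i m] gt by (simp add: N_def mult.assoc)
    have m: "int m = int N + int r * int i"
      using ri by (simp add: N_def of_nat_diff)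
    have "fact (Suc i) * (packing_term r (m + Suc r) (Suc i)
        - int (m + Suc r) * packing_term r (m + r) (Suc i) + int r * packing_term r m i)
      = fact (Suc i) * packing_term r (m + Suc r) (Suc i)
        - int (m + Suc r) * (fact (Suc i) * packing_term r (m + r) (Suc i))
        + int r * (fact (Suc i) * packing_term r m i)"
      by (simp only: algebra_simps)
    also have "\<dots> = fact (Suc N) - int (m + Suc r) * fact N + int r * (int (Suc i) * fact N)"
      unfolding 1 2 3 ..
    also have "\<dots> = 0"
      by (simp add: m algebra_simps)
    finally have "packing_term r (m + Suc r) (Suc i)
        - int (m + Suc r) * packing_term r (m + r) (Suc i) + int r * packing_term r m i = 0"
      by (metis fact_nonzero mult_eq_0_iff)
    then show ?thesis
      using gt by simp
  next
    case lt
    then have "i > 0"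
      by (auto intro: gr0I)
    then show ?thesis
      using lt by (simp add: packing_term_eq_0)
  qed
qed

text \<open>The recurrence with \<open>q = Suc r\<close> and \<open>n = m + q\<close>: summing \<open>packing_term_recurrence\<close> with
  alternating signs shifts the index by one in the sum for \<open>b\<^sub>m\<close>, and the exceptional index
  \<open>i = m div q\<close> contributes only if \<open>q\<close> divides \<open>m\<close>.\<close>

lemma b_seq_recurrence:
  "b_seq (Suc r) (int (m + Suc r)) - int (m + Suc r) * b_seq (Suc r) (int (m + r))
     = int r * b_seq (Suc r) (int m)
       + (if Suc r dvd m then int (Suc r) * (- 1) ^ Suc (m div Suc r) else 0)"
proof -
  let ?n = "m + Suc r"
  let ?T = "packing_term r"
  have "b_seq (Suc r) (int ?n) - int ?n * b_seq (Suc r) (int (m + r))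
      = (\<Sum>j<Suc ?n. (- 1) ^ j * (?T ?n j - int ?n * ?T (m + r) j))"
  proof -
    have 1: "b_seq (Suc r) (int ?n) = (\<Sum>j<Suc ?n. (- 1) ^ j * ?T ?n j)"
      by (rule b_seq_formula) simp
    have 2: "b_seq (Suc r) (int (m + r)) = (\<Sum>j<Suc ?n. (- 1) ^ j * ?T (m + r) j)"
      by (rule b_seq_formula) simp
    show ?thesis
      unfolding 1 2 sum_distrib_left sum_subtractf[symmetric]
      by (rule sum.cong[OF refl]) (simp only: right_diff_distrib mult.left_commute)
  qed
  \<comment> \<open>The summand for \<open>j = 0\<close> is \<open>fact n - n * fact (n - 1) = 0\<close>.\<close>
  also have "\<dots> = (\<Sum>i<?n. (- 1) ^ Suc i * (?T ?n (Suc i) - int ?n * ?T (m + r) (Suc i)))"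
    by (subst sum.lessThan_Suc_shift) (simp add: packing_term_def algebra_simps)
  also have "\<dots> = (\<Sum>i<?n. int r * ((- 1) ^ i * ?T m i)
      + (if m = Suc r * i then int (Suc r) * (- 1) ^ Suc i else 0))"
  proof (rule sum.cong[OF refl])
    fix i
    have "?T ?n (Suc i) - int ?n * ?T (m + r) (Suc i)
        = (if m = Suc r * i then int (Suc r) else 0) - int r * ?T m i"
      using packing_term_recurrence[of r m i] by linarith
    then show "(- 1) ^ Suc i * (?T ?n (Suc i) - int ?n * ?T (m + r) (Suc i))
        = int r * ((- 1) ^ i * ?T m i) + (if m = Suc r * i then int (Suc r) * (- 1) ^ Suc i else 0)"
      by (simp only:) (simp add: algebra_simps)
  qed
  also have "\<dots> = int r * b_seq (Suc r) (int m)
      + (\<Sum>i<?n. if m = Suc r * i then int (Suc r) * (- 1) ^ Suc i else 0)"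
  proof -
    have "b_seq (Suc r) (int m) = (\<Sum>i<?n. (- 1) ^ i * ?T m i)"
      by (rule b_seq_formula) simp
    then show ?thesis
      by (simp only: sum.distrib sum_distrib_left)
  qed
  also have "(\<Sum>i<?n. if m = Suc r * i then int (Suc r) * (- 1) ^ Suc i else 0)
      = (if Suc r dvd m then int (Suc r) * (- 1) ^ Suc (m div Suc r) else 0)"
  proof (cases "Suc r dvd m")
    case True
    then obtain k where k: "m = Suc r * k" ..
    then have "k < ?n"
      by simp
    moreover have "m div Suc r = k"
      unfolding k by (rule nonzero_mult_div_cancel_left) simp
    moreover have "m = Suc r * i \<longleftrightarrow> k = i" for i
      using k by (metis nat_mult_eq_cancel_disj nat.simps(3))
    ultimately show ?thesis
      using True by (simp add: sum.delta' del: mult_Suc)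
  next
    case False
    then have "m \<noteq> Suc r * i" for i
      by (metis dvd_triv_left)
    then show ?thesis
      using False by (simp del: mult_Suc)
  qed
  finally show ?thesis .
qed

lemma b_seq_short:
  assumes "n < q"
  shows "b_seq q (int n) = fact n"
proof -
  have "q \<ge> 1"
    using assms by simp
  then show ?thesis
    by (simp add: b_seq_inclusion_exclusion packings_too_short[OF assms])
qed

theorem theorem3p1:
  fixes q n :: nat
  assumes "q \<ge> 1" and "n \<ge> 1"
  shows "b_seq q (int n) - int n * b_seq q (int n - 1) =
    (if q dvd n
     then (int q - 1) * b_seq q (int n - int q) + int q * (- 1) ^ (n div q)
     else (int q - 1) * b_seq q (int n - int q))"
proof (cases "n < q")
  case True
  \<comment> \<open>Every permutation avoids adjacent \<open>q\<close>-cycles here, and both sides are zero.\<close>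
  obtain k where k: "n = Suc k"
    using assms(2) by (cases n) auto
  have "b_seq q (int n) - int n * b_seq q (int k) = 0"
    using True k b_seq_short[of n q] b_seq_short[of k q] by simp
  moreover have "b_seq q (int n - int q) = 0"
    using True by (simp add: b_seq_def)
  moreover have "\<not> q dvd n"
    using True assms(2) by (auto dest: dvd_imp_le)
  ultimately show ?thesis
    using k by simp
next
  case False
  obtain r where r: "q = Suc r"
    using assms(1) by (cases q) auto
  obtain m where m: "n = m + Suc r"
    using False r by (metis add.commute le_Suc_ex not_le)
  have "int n - 1 = int (m + r)" "int n - int q = int m"
    using m r by simp_all
  moreover have "q dvd n \<longleftrightarrow> Suc r dvd m"
    using m r by (metis dvd_add_left_iff dvd_refl)
  moreover have "n div q = Suc (m div Suc r)"
    unfolding m r by (rule div_add_self2[THEN trans]) simp_all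
  ultimately show ?thesis
    using b_seq_recurrence[of r m] m r by simp
qed

end
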